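(* Let $(\Omega,\mathcal{F},\mathbb{P},\sigma)$ be a measure-preserving dynamical system. Let $f\in\mathcal{H}(\Omega)$ and let $F\in\tilde{\mathcal{H}}(\Omega)$ be the standard lift of $f$. Then, for each $x_0\in S^1$, $n\in\mathbb{N}$ and $\omega\in\Omega$, $$V_f(n,\omega,x_0,0)=B_f(n,\omega,x_0),$$ and, for each $x_0\in S^1$ and for $\mathbb{P}$-almost every $\omega\in\Omega$, $$\lim_{n\to\infty}V_f(n,\omega,x_0,0)=\rho_F(\omega).$$ Moreover, if $f$ has no fixed points (that is, $f_\omega(x)\neq x$ for all $\omega\in\Omega$ and $x\in S^1$), then for each $x_0\in S^1$, any $z\in S^1$ and $\mathbb{P}$-almost every $\omega\in\Omega$, $$\lim_{n\to\infty}V_f(n,\omega,x_0,z)=\rho_F(\omega).$$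
   Context: Circle and lifts. $S^1=\mathbb{R}/\mathbb{Z}$ is parametrized by $[0,1)$, and $\pi:\mathbb{R}\to S^1$ is $\pi(x)=x-\lfloor x\rfloor$. $\tilde{\mathcal{H}}$ is the set of increasing homeomorphisms $F:\mathbb{R}\to\mathbb{R}$ with $F(x+1)=F(x)+1$ for all $x$. $\mathcal{H}$ is the set of orientation-preserving homeomorphisms $f:S^1\to S^1$, i.e. those for which there is $F\in\tilde{\mathcal{H}}$ (a lift of $f$) with $\pi\circ F=f\circ\pi$; the lift is unique up to adding an integer. Put $\Delta_F(x)=F(x)-x$ and $\|\Delta_F\|=\sup_{x\in\mathbb{R}}|\Delta_F(x)|$. $\tilde{\mathcal{H}}$ carries the metric $\sup_x|F(x)-G(x)|$, and $\mathcal{H}$ the metric given by the infimum of this quantity over lifts $F$ of $f$ and $G$ of $g$; measurability of maps into these spaces is with respect to the Borel $\sigma$-algebras. Random circle homeomorphisms. A measure-preserving dynamical system $(\Omega,\mathcal{F},\mathbb{P},\sigma)$ is a probability space with a measurable map $\sigma:\Omega\to\Omega$ (not assumed invertible or ergodic) such that $\mathbb{P}(\sigma^{-1}(A))=\mathbb{P}(A)$ for all $A\in\mathcal{F}$. $\mathcal{H}(\Omega)$ is the set of measurable maps $f:\Omega\to\mathcal{H}$, $\omega\mapsto f_\omega$. For $n\ge 1$, $f^{(n)}_\omega=f_{\sigma^{n-1}\omega}\circ\cdots\circ f_{\sigma\omega}\circ f_\omega$, and $f^{(0)}_\omega=\mathrm{Id}$. A measurable $F:\Omega\to\tilde{\mathcal{H}}$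 is a lift of $f$ if $\pi\circ F_\omega=f_\omega\circ\pi$ for every $\omega$; $F^{(n)}_\omega$ is defined analogously. $\tilde{\mathcal{H}}(\Omega)$ is the set of measurable $F:\Omega\to\tilde{\mathcal{H}}$ with $\int_\Omega\|\Delta_{F_\omega}\|\,\mathrm{d}\mathbb{P}(\omega)<\infty$. The standard lift of $f$ is the unique lift $F$ with $F_\omega(0)\in[0,1)$ for each $\omega\in\Omega$. Random rotation number. For $F\in\tilde{\mathcal{H}}(\Omega)$, it is known (Li–Lu) that there is a function $\rho_F\in L^1(\Omega)$, the random rotation number, such that for each $x\in\mathbb{R}$, $\lim_{n\to\infty}\frac{F^{(n)}_\omega(x)-x}{n}=\rho_F(\omega)$ for $\mathbb{P}$-almost every $\omega$. Binary coding frequency. Let $\hat f_\omega:[0,1)\to[0,1)$ be $f_\omega$ regarded as a map of the interval $[0,1)$ (similarly $\hat f^{(k)}_\omega$ for $f^{(k)}_\omega$), and let $c_\omega=f_\omega^{-1}(0)\in[0,1)$. Let $J_\omega=[c_\omega,1)$ if $\hat f_\omega(0)\neq0$ and $J_\omega=\emptyset$ if $\hat f_\omega(0)=0$, and let $S_\omega=\chi_{J_\omega}$ be the indicator function of $J_\omega$. For $x_0\in S^1$ (identified with $[0,1)$), $\omega\in\Omega$, $n\in\mathbb{N}=\{1,2,\dots\}$, $$B_f(n,\omega,x_0)=\frac1n\sum_{k=0}^{n-1}S_{\sigma^k\omega}\bigl(\hat f^{(k)}_\omega(x_0)\bigr).$$ Visit frequency. For $a,b\in S^1=[0,1)$, $[a,b)\subset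 S^1$ denotes the half-open positively oriented arc from $a$ to $b$: the usual interval if $a<b$, the set $[a,1)\cup[0,b)$ if $b<a$, and $\emptyset$ if $a=b$. For $x_0,z\in S^1$, $\omega\in\Omega$, $n\in\mathbb{N}$, $$V_f(n,\omega,x_0,z)=\frac1n\,\#\{1\le i\le n:\ f^{(i)}_\omega(x_0)\in[z,f_{\sigma^{i-1}\omega}(z))\}.$$ *)

theory Defs
  imports "HOL-Probability.Probability"
begin

section \<open>The circle, its homeomorphisms and their lifts\<close>

text \<open>The circle is parametrized by the half-open unit interval; the projection
  from the line to the circle is \<^const>\<open>frac\<close>.\<close>

abbreviation circle :: "real set"
  where "circle \<equiv> {0..<1}"

definition lift_homeos :: "(real \<Rightarrow> real) set"
  where "lift_homeos =
    {F. strict_mono F \<and> (\<exists>G. homeomorphism UNIV UNIV F G) \<and> (\<forall>x. F (x + 1) = F x + 1)}"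

definition is_lift :: "(real \<Rightarrow> real) \<Rightarrow> (real \<Rightarrow> real) \<Rightarrow> bool"
  where "is_lift F f \<longleftrightarrow> F \<in> lift_homeos \<and> (\<forall>x. frac (F x) = f (frac x))"

text \<open>Self-maps of the circle are \<^const>\<open>undefined\<close> off \<^term>\<open>circle\<close>, so that two of
  them are equal as HOL functions exactly when they agree on the circle.\<close>

definition circle_homeos :: "(real \<Rightarrow> real) set"
  where "circle_homeos = {f \<in> circle \<rightarrow>\<^sub>E circle. \<exists>F. is_lift F f}"

definition lift_dist :: "(real \<Rightarrow> real) \<Rightarrow> (real \<Rightarrow> real) \<Rightarrow> real"
  where "lift_dist F G =
    (if F \<in> lift_homeos \<and> G \<in> lift_homeos then SUP x. \<bar>F x - G x\<bar> else 0)"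

definition circle_dist :: "(real \<Rightarrow> real) \<Rightarrow> (real \<Rightarrow> real) \<Rightarrow> real"
  where "circle_dist f g =
    (if f \<in> circle_homeos \<and> g \<in> circle_homeos
     then Inf {lift_dist F G |F G. is_lift F f \<and> is_lift G g} else 0)"

definition displacement_norm :: "(real \<Rightarrow> real) \<Rightarrow> real"
  where "displacement_norm F = (SUP x. \<bar>F x - x\<bar>)"

text \<open>The two distances are 0 off their carriers because \<^locale>\<open>Metric_space\<close> requires
  a distance to be nonnegative and symmetric on the whole type. The suprema and the infimum above are taken in \<^typ>\<open>real\<close>, where they are only
  meaningful for bounded sets, nonempty in the case of the infimum. The next lemmas show
  that this is so and that the two distances are metrics.\<close>

lemma lift_homeos_add_int:
  assumes "F \<in> lift_homeos"
  shows "F (x + of_int k) = F x + of_int k"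
proof -
  have step: "F (y + 1) = F y + 1" for y
    using assms by (simp add: lift_homeos_def)
  have nat: "F (y + of_nat n) = F y + of_nat n" for y n
  proof (induction n)
    case (Suc n)
    then show ?case
      using step[of "y + of_nat n"] by (simp add: algebra_simps)
  qed simp
  show ?thesis
  proof (cases "k \<ge> 0")
    case True
    then show ?thesis using nat[of x "nat k"] by simp
  next
    case False
    then show ?thesis using nat[of "x + of_int k" "nat (- k)"] by simp
  qed
qed

lemma displacement_bound:
  assumes "F \<in> lift_homeos"
  shows "\<bar>F x - x\<bar> \<le> \<bar>F 0\<bar> + 1"
proof -
  have mono: "mono F"
    using assms by (simp add: lift_homeos_def strict_mono_mono)
  have "F x = F (frac x) + of_int \<lfloor>x\<rfloor>"
    using lift_homeos_add_int[OF assms, of "frac x" "\<lfloor>x\<rfloor>"] by (simp add: frac_def)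
  moreover have "F 0 \<le> F (frac x)" "F (frac x) \<le> F 0 + 1"
    using monoD[OF mono, of 0 "frac x"] monoD[OF mono, of "frac x" 1]
      lift_homeos_add_int[OF assms, of 0 1] frac_lt_1[of x] by auto
  moreover have "x = frac x + of_int \<lfloor>x\<rfloor>" by (simp add: frac_def)
  ultimately show ?thesis using frac_lt_1[of x] frac_ge_0[of x] by linarith
qed

lemma bdd_above_displacement:
  assumes "F \<in> lift_homeos"
  shows "bdd_above (range (\<lambda>x. \<bar>F x - x\<bar>))"
  using displacement_bound[OF assms] by (intro bdd_aboveI2)

lemma bdd_above_lift_diff:
  assumes "F \<in> lift_homeos" "G \<in> lift_homeos"
  shows "bdd_above (range (\<lambda>x. \<bar>F x - G x\<bar>))"
proof (intro bdd_aboveI2)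
  fix x
  show "\<bar>F x - G x\<bar> \<le> \<bar>F 0\<bar> + 1 + (\<bar>G 0\<bar> + 1)"
    using displacement_bound[OF assms(1), of x] displacement_bound[OF assms(2), of x] by linarith
qed

lemma lift_dist_upper:
  assumes "F \<in> lift_homeos" "G \<in> lift_homeos"
  shows "\<bar>F x - G x\<bar> \<le> lift_dist F G"
proof -
  have "\<bar>F x - G x\<bar> \<le> (SUP x. \<bar>F x - G x\<bar>)"
    using bdd_above_lift_diff[OF assms] by (intro cSUP_upper) auto
  then show ?thesis using assms by (simp add: lift_dist_def)
qed

lemma lift_dist_least:
  assumes "F \<in> lift_homeos" "G \<in> lift_homeos" "\<And>x. \<bar>F x - G x\<bar> \<le> b"
  shows "lift_dist F G \<le> b"
proof -
  have "(SUP x. \<bar>F x - G x\<bar>) \<le> b"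
    using assms(3) by (intro cSUP_least) auto
  then show ?thesis using assms by (simp add: lift_dist_def)
qed

lemma lift_dist_nonneg: "0 \<le> lift_dist F G"
proof (cases "F \<in> lift_homeos \<and> G \<in> lift_homeos")
  case True
  then show ?thesis using lift_dist_upper[of F G 0] by linarith
qed (auto simp: lift_dist_def)

lemma Metric_space_lift: "Metric_space lift_homeos lift_dist"
proof
  show "lift_dist F G = lift_dist G F" for F G
    by (simp add: lift_dist_def abs_minus_commute)
next
  fix F G assume FG: "F \<in> lift_homeos" "G \<in> lift_homeos"
  show "lift_dist F G = 0 \<longleftrightarrow> F = G"
  proof
    assume "lift_dist F G = 0"
    then show "F = G" using lift_dist_upper[OF FG] by (intro ext) simp
  next
    assume "F = G"
    then show "lift_dist F G = 0"
      using lift_dist_least[OF FG, of 0] lift_dist_nonneg[of F G] by simp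
  qed
next
  fix F G K assume FGK: "F \<in> lift_homeos" "G \<in> lift_homeos" "K \<in> lift_homeos"
  show "lift_dist F K \<le> lift_dist F G + lift_dist G K"
  proof (rule lift_dist_least[OF FGK(1,3)])
    show "\<bar>F x - K x\<bar> \<le> lift_dist F G + lift_dist G K" for x
      using lift_dist_upper[OF FGK(1,2), of x] lift_dist_upper[OF FGK(2,3), of x] by linarith
  qed
qed (rule lift_dist_nonneg)

lemma is_lift_add_int:
  assumes "is_lift F f"
  shows "is_lift (\<lambda>x. F x + of_int k) f"
proof -
  have F: "strict_mono F" "\<And>x. F (x + 1) = F x + 1" "\<And>x. frac (F x) = f (frac x)"
    using assms by (auto simp: is_lift_def lift_homeos_def)
  obtain G where G: "homeomorphism UNIV UNIV F G"
    using assms by (auto simp: is_lift_def lift_homeos_def)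
  have "homeomorphism UNIV UNIV (\<lambda>x. x + of_int k) (\<lambda>x::real. x - of_int k)"
    by (intro homeomorphismI continuous_intros) auto
  from homeomorphism_compose[OF G this]
  have "\<exists>G. homeomorphism UNIV UNIV (\<lambda>x. F x + of_int k) G"
    by (auto simp: o_def)
  then show ?thesis
    using F by (auto simp: is_lift_def lift_homeos_def strict_mono_def frac_def)
qed

lemma is_lift_unique:
  assumes "is_lift F f" "is_lift F' f"
  obtains k :: int where "\<And>x. F' x = F x + of_int k"
proof -
  have cont: "continuous_on UNIV F" "continuous_on UNIV F'"
    using assms by (auto simp: is_lift_def lift_homeos_def homeomorphism_def)
  have int: "F' x - F x \<in> \<int>" for x
  proof -
    have "frac (F' x) = frac (F x)" using assms by (simp add: is_lift_def)
    then have "F' x - F x = of_int (\<lfloor>F' x\<rfloor> - \<lfloor>F x\<rfloor>)" by (simp add: frac_def)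
    then show ?thesis by (metis Ints_of_int)
  qed
  have "(\<lambda>x. F' x - F x) constant_on UNIV"
  proof (rule continuous_discrete_range_constant)
    show "continuous_on UNIV (\<lambda>x. F' x - F x)"
      by (intro continuous_intros cont)
    fix x
    have "1 \<le> norm (F' y - F y - (F' x - F x))" if "F' y - F y \<noteq> F' x - F x" for y
      unfolding real_norm_def
      by (rule Ints_nonzero_abs_ge1[OF Ints_diff[OF int int]]) (use that in linarith)
    then show "\<exists>e>0. \<forall>y. y \<in> UNIV \<and> F' y - F y \<noteq> F' x - F x \<longrightarrow>
        e \<le> norm (F' y - F y - (F' x - F x))"
      using zero_less_one by blast
  qed auto
  then obtain c where c: "\<And>x. F' x - F x = c" by (auto simp: constant_on_def)
  moreover obtain k where "c = of_int k" using int[of 0] c by (metis Ints_cases)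
  ultimately show ?thesis using that[of k] by (simp add: algebra_simps)
qed

lemma circle_dist_lower:
  assumes "f \<in> circle_homeos" "g \<in> circle_homeos" "circle_dist f g < b"
  obtains F G where "is_lift F f" "is_lift G g" "lift_dist F G < b"
proof -
  let ?S = "{lift_dist F G |F G. is_lift F f \<and> is_lift G g}"
  have "?S \<noteq> {}" using assms(1,2) by (auto simp: circle_homeos_def)
  moreover have "Inf ?S < b" using assms by (simp add: circle_dist_def)
  ultimately have "\<exists>s\<in>?S. s < b" by (rule cInf_lessD)
  then show ?thesis using that by blast
qed

lemma circle_dist_upper:
  assumes "f \<in> circle_homeos" "g \<in> circle_homeos" "is_lift F f" "is_lift G g"
  shows "circle_dist f g \<le> lift_dist F G"
proof -
  have "Inf {lift_dist F G |F G. is_lift F f \<and> is_lift G g} \<le> lift_dist F G"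
    using assms lift_dist_nonneg by (intro cInf_lower bdd_belowI[of _ 0]) auto
  then show ?thesis using assms by (simp add: circle_dist_def)
qed

lemma circle_dist_nonneg: "0 \<le> circle_dist f g"
proof (rule ccontr)
  assume "\<not> 0 \<le> circle_dist f g"
  then have neg: "circle_dist f g < 0" by simp
  then have fg: "f \<in> circle_homeos" "g \<in> circle_homeos"
    by (auto simp: circle_dist_def split: if_splits)
  obtain F G where "lift_dist F G < 0" by (rule circle_dist_lower[OF fg neg])
  then show False using lift_dist_nonneg[of F G] by simp
qed

lemma Metric_space_circle: "Metric_space circle_homeos circle_dist"
proof
  fix f g
  have "{lift_dist F G |F G. is_lift F f \<and> is_lift G g} =
        {lift_dist F G |F G. is_lift F g \<and> is_lift G f}"
    using Metric_space.commute[OF Metric_space_lift] by blast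
  then show "circle_dist f g = circle_dist g f"
    by (simp add: circle_dist_def)
next
  fix f g assume fg: "f \<in> circle_homeos" "g \<in> circle_homeos"
  show "circle_dist f g = 0 \<longleftrightarrow> f = g"
  proof
    assume d0: "circle_dist f g = 0"
    have "f x = g x" if "x \<in> circle" for x
    proof (rule ccontr)
      assume neq: "f x \<noteq> g x"
      have rng: "f x \<in> circle" "g x \<in> circle"
        using fg that by (auto simp: circle_homeos_def)
      define e where "e = min \<bar>f x - g x\<bar> (1 - \<bar>f x - g x\<bar>)"
      have "e > 0" using neq rng by (auto simp: e_def)
      then obtain F G where FG: "is_lift F f" "is_lift G g" "lift_dist F G < e"
        using circle_dist_lower[OF fg, of e] d0 by metis
      have "\<bar>F x - G x\<bar> < e"
        using lift_dist_upper[of F G x] FG by (auto simp: is_lift_def)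
      moreover have "frac x = x" using that by (simp add: frac_eq)
      then have "F x = f x + of_int \<lfloor>F x\<rfloor>" "G x = g x + of_int \<lfloor>G x\<rfloor>"
        using FG by (metis is_lift_def frac_def diff_add_cancel)+
      ultimately have lt: "\<bar>f x - g x + of_int (\<lfloor>F x\<rfloor> - \<lfloor>G x\<rfloor>)\<bar> < e" by simp
      define k where "k = \<lfloor>F x\<rfloor> - \<lfloor>G x\<rfloor>"
      consider "k = 0" | "k \<ge> 1" | "k \<le> -1" by linarith
      then show False
      proof cases
        case 1
        then show False using lt by (simp add: e_def k_def)
      next
        case 2
        then have "real_of_int k \<ge> 1" by simp
        then show False using lt unfolding k_def[symmetric] e_def by linarith
      next
        case 3
        then have "real_of_int k \<le> -1" by linarith
        then show False using lt unfolding k_def[symmetric] e_def by linarith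
      qed
    qed
    then show "f = g"
      using fg by (intro extensionalityI[of _ circle]) (auto simp: circle_homeos_def PiE_def)
  next
    assume "f = g"
    moreover obtain F where F: "is_lift F f" using fg by (auto simp: circle_homeos_def)
    ultimately have "circle_dist f g \<le> lift_dist F F" using circle_dist_upper fg by blast
    also have "\<dots> = 0"
      using F Metric_space.zero[OF Metric_space_lift, of F F] by (simp add: is_lift_def)
    finally show "circle_dist f g = 0" using circle_dist_nonneg[of f g] by simp
  qed
next
  fix f g h assume fgh: "f \<in> circle_homeos" "g \<in> circle_homeos" "h \<in> circle_homeos"
  show "circle_dist f h \<le> circle_dist f g + circle_dist g h"
  proof (rule field_le_epsilon)
    fix e :: real assume "e > 0"
    then obtain F G where FG: "is_lift F f" "is_lift G g" "lift_dist F G < circle_dist f g + e / 2"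
      using circle_dist_lower[OF fgh(1,2), of "circle_dist f g + e / 2"]
      by (metis half_gt_zero less_add_same_cancel1)
    obtain G' H where GH: "is_lift G' g" "is_lift H h" "lift_dist G' H < circle_dist g h + e / 2"
      using circle_dist_lower[OF fgh(2,3), of "circle_dist g h + e / 2"] \<open>e > 0\<close>
      by (metis half_gt_zero less_add_same_cancel1)
    obtain k where k: "\<And>x. G' x = G x + of_int k"
      using is_lift_unique[OF FG(2) GH(1)] by blast
    define H' where "H' x = H x + of_int (- k)" for x
    have H': "is_lift H' h"
      unfolding H'_def by (rule is_lift_add_int[OF GH(2)])
    have "lift_dist G H' \<le> lift_dist G' H"
    proof (rule lift_dist_least)
      show "\<bar>G x - H' x\<bar> \<le> lift_dist G' H" for x
        using lift_dist_upper[of G' H x] GH k[of x] by (simp add: H'_def is_lift_def algebra_simps)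
    qed (use FG H' in \<open>auto simp: is_lift_def\<close>)
    moreover have "circle_dist f h \<le> lift_dist F H'"
      using circle_dist_upper fgh FG H' by blast
    moreover have "lift_dist F H' \<le> lift_dist F G + lift_dist G H'"
      using Metric_space.triangle[OF Metric_space_lift] FG H' by (auto simp: is_lift_def)
    ultimately show "circle_dist f h \<le> circle_dist f g + circle_dist g h + e"
      using FG(3) GH(3) by linarith
  qed
qed (rule circle_dist_nonneg)


section \<open>Random circle homeomorphisms\<close>

definition borel_of :: "'a topology \<Rightarrow> 'a measure"
  where "borel_of X = sigma (topspace X) {U. openin X U}"

locale measure_preserving_system = prob_space M for M :: "'w measure" +
  fixes \<sigma> :: "'w \<Rightarrow> 'w"
  assumes shift_measurable: "\<sigma> \<in> M \<rightarrow>\<^sub>M M"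
    and shift_preserving: "\<And>A. A \<in> sets M \<Longrightarrow> prob (\<sigma> -` A \<inter> space M) = prob A"

definition random_circle_homeos :: "'w measure \<Rightarrow> ('w \<Rightarrow> real \<Rightarrow> real) set"
  where "random_circle_homeos M =
    (M \<rightarrow>\<^sub>M borel_of (Metric_space.mtopology circle_homeos circle_dist))"

definition integrable_random_lifts :: "'w measure \<Rightarrow> ('w \<Rightarrow> real \<Rightarrow> real) set"
  where "integrable_random_lifts M =
    {F \<in> M \<rightarrow>\<^sub>M borel_of (Metric_space.mtopology lift_homeos lift_dist).
      integrable M (\<lambda>\<omega>. displacement_norm (F \<omega>))}"

definition random_lift :: "'w measure \<Rightarrow> ('w \<Rightarrow> real \<Rightarrow> real) \<Rightarrow> ('w \<Rightarrow> real \<Rightarrow> real) \<Rightarrow> bool"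
  where "random_lift M F f \<longleftrightarrow>
    F \<in> M \<rightarrow>\<^sub>M borel_of (Metric_space.mtopology lift_homeos lift_dist) \<and>
    (\<forall>\<omega>\<in>space M. is_lift (F \<omega>) (f \<omega>))"

definition standard_lift :: "'w measure \<Rightarrow> ('w \<Rightarrow> real \<Rightarrow> real) \<Rightarrow> ('w \<Rightarrow> real \<Rightarrow> real) \<Rightarrow> bool"
  where "standard_lift M F f \<longleftrightarrow> random_lift M F f \<and> (\<forall>\<omega>\<in>space M. F \<omega> 0 \<in> {0..<1})"

primrec iterate :: "('w \<Rightarrow> 'w) \<Rightarrow> ('w \<Rightarrow> real \<Rightarrow> real) \<Rightarrow> nat \<Rightarrow> 'w \<Rightarrow> real \<Rightarrow> real"
  where
    "iterate \<sigma> f 0 \<omega> = id"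
  | "iterate \<sigma> f (Suc n) \<omega> = f ((\<sigma> ^^ n) \<omega>) \<circ> iterate \<sigma> f n \<omega>"

text \<open>The random rotation number is only determined up to null sets, so it is
  given as a predicate that holds of each of its versions.\<close>

definition random_rotation_number ::
    "'w measure \<Rightarrow> ('w \<Rightarrow> 'w) \<Rightarrow> ('w \<Rightarrow> real \<Rightarrow> real) \<Rightarrow> ('w \<Rightarrow> real) \<Rightarrow> bool"
  where "random_rotation_number M \<sigma> F \<rho> \<longleftrightarrow>
    integrable M \<rho> \<and>
    (\<forall>x. AE \<omega> in M. (\<lambda>n. (iterate \<sigma> F n \<omega> x - x) / real n) \<longlonglongrightarrow> \<rho> \<omega>)"


section \<open>Binary coding and visit frequencies\<close>

definition coding_interval :: "(real \<Rightarrow> real) \<Rightarrow> real set"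
  where "coding_interval g = (if g 0 \<noteq> 0 then {the_inv_into circle g 0..<1} else {})"

definition coding_frequency ::
    "('w \<Rightarrow> 'w) \<Rightarrow> ('w \<Rightarrow> real \<Rightarrow> real) \<Rightarrow> nat \<Rightarrow> 'w \<Rightarrow> real \<Rightarrow> real"
  where "coding_frequency \<sigma> f n \<omega> x0 =
    (\<Sum>k<n. indicator (coding_interval (f ((\<sigma> ^^ k) \<omega>))) (iterate \<sigma> f k \<omega> x0)) / real n"

definition circle_arc :: "real \<Rightarrow> real \<Rightarrow> real set"
  where "circle_arc a b = (if a < b then {a..<b} else if b < a then {a..<1} \<union> {0..<b} else {})"

definition visit_frequency ::
    "('w \<Rightarrow> 'w) \<Rightarrow> ('w \<Rightarrow> real \<Rightarrow> real) \<Rightarrow> nat \<Rightarrow> 'w \<Rightarrow> real \<Rightarrow> real \<Rightarrow> real"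
  where "visit_frequency \<sigma> f n \<omega> x0 z =
    real (card {i \<in> {1..n}. iterate \<sigma> f i \<omega> x0 \<in> circle_arc z (f ((\<sigma> ^^ (i - 1)) \<omega>) z)}) / real n"

end

theory Submission
  imports Defs
begin

text \<open>Fix \<open>z\<close>. If a lift \<open>G\<close> satisfies \<open>z \<le> G z < z + 1\<close>, then \<open>\<lfloor>G x - z\<rfloor> - \<lfloor>x - z\<rfloor>\<close> is 1 or 0,
  and it is 1 exactly when the image of \<open>x\<close> on the circle lies in the arc from \<open>z\<close> to the image
  of \<open>z\<close>. Summing along an orbit, the number of visits telescopes to
  \<open>\<lfloor>F\<^sup>n x\<^sub>0 - z\<rfloor> - \<lfloor>x\<^sub>0 - z\<rfloor>\<close>, which differs from \<open>F\<^sup>n x\<^sub>0 - x\<^sub>0\<close> by at most 1. The standard lift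
  satisfies the hypothesis for \<open>z = 0\<close>, and in the absence of fixed points for every \<open>z\<close>, by the
  intermediate value theorem.\<close>

section \<open>Lifts and half-open arcs\<close>

lemma lift_strict_mono:
  assumes "is_lift G g"
  shows "strict_mono G"
  using assms by (simp add: is_lift_def lift_homeos_def)

lemma lift_add_int:
  assumes "is_lift G g"
  shows "G (x + of_int k) = G x + of_int k"
  using assms lift_homeos_add_int by (simp add: is_lift_def)

lemma frac_lift:
  assumes "is_lift G g"
  shows "frac (G x) = g (frac x)"
  using assms by (simp add: is_lift_def)

lemma lift_continuous:
  assumes "is_lift G g"
  shows "continuous_on A G"
proof -
  have "continuous_on UNIV G"
    using assms by (auto simp: is_lift_def lift_homeos_def homeomorphism_def)
  then show ?thesis by (rule continuous_on_subset) simp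
qed

text \<open>Rotating \<open>a\<close> to 0 turns the arc into \<open>[0, b - a)\<close>, which
  removes the case split on whether the arc passes through 0. The bound \<open>b < a + 1\<close>
  matters: at \<open>b = a + 1\<close> the arc would be empty while the right-hand side would always
  hold.\<close>

lemma frac_in_circle_arc_iff:
  assumes "a \<in> circle" "a \<le> b" "b < a + 1"
  shows "frac w \<in> circle_arc a (frac b) \<longleftrightarrow> frac (w - a) < b - a"
proof -
  have b: "frac b = (if b < 1 then b else b - 1)"
    using assms by (auto intro!: frac_unique_iff[THEN iffD2])
  have "frac (w - a) = (if a \<le> frac w then frac w - a else frac w - a + 1)"
  proof -
    \<comment> \<open>Both candidates differ from \<open>w - a\<close> by an integer, so the one
      lying in \<open>[0, 1)\<close> is its fractional part.\<close>
    have "w - a - (frac w - a) \<in> \<int>" "w - a - (frac w - a + 1) \<in> \<int>"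
      by (simp_all add: frac_def)
    moreover have "0 \<le> frac w" "frac w < 1" "0 \<le> a" "a < 1"
      using assms(1) frac_lt_1 frac_ge_0 by auto
    ultimately show ?thesis
      unfolding frac_unique_iff by (smt (verit))
  qed
  moreover have "0 \<le> frac w" "frac w < 1"
    using frac_lt_1 frac_ge_0 by auto
  ultimately show ?thesis
    unfolding b circle_arc_def using assms by (auto simp del: frac_ge_0)
qed

text \<open>Integer translations cancel, so \<open>x\<close> may be replaced by its representative
  \<open>t\<close> in \<open>[z, z + 1)\<close>. Then \<open>G t\<close> lies in
  \<open>[G z, G z + 1)\<close>. Below \<open>z + 1\<close> the floor is 0 and the fractional part
  of \<open>G t - z\<close> is at least \<open>G z - z\<close>; from \<open>z + 1\<close> on the
  floor is 1 and the fractional part is smaller than \<open>G z - z\<close>.\<close>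

lemma floor_lift_diff:
  assumes "is_lift G g" "z \<in> circle" "z \<le> G z" "G z < z + 1"
  shows "real_of_int \<lfloor>G x - z\<rfloor> - of_int \<lfloor>x - z\<rfloor> = indicator (circle_arc z (g z)) (g (frac x))"
proof -
  note mono = strict_mono_mono[OF lift_strict_mono[OF assms(1)]]
  define t where "t = z + frac (x - z)"
  have x: "x = t + of_int \<lfloor>x - z\<rfloor>" by (simp add: t_def frac_def)
  have t: "z \<le> t" "t < z + 1" using frac_lt_1[of "x - z"] by (simp_all add: t_def)
  have Gx: "G x = G t + of_int \<lfloor>x - z\<rfloor>"
    by (metis x lift_add_int[OF assms(1)])
  have Gt: "G z \<le> G t" "G t < G z + 1"
    using monoD[OF mono t(1)] strict_monoD[OF lift_strict_mono[OF assms(1)] t(2)]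
      lift_add_int[OF assms(1), of z 1] by simp_all
  have "frac (G z) = g z"
    using frac_lift[OF assms(1), of z] assms(2) by (simp add: frac_eq)
  then have "g (frac x) \<in> circle_arc z (g z) \<longleftrightarrow> frac (G x - z) < G z - z"
    using frac_in_circle_arc_iff[OF assms(2-4), of "G x"] frac_lift[OF assms(1), of x] by simp
  moreover have floor: "\<lfloor>G x - z\<rfloor> = \<lfloor>G t - z\<rfloor> + \<lfloor>x - z\<rfloor>"
    by (simp add: Gx diff_add_eq[symmetric])
  moreover have "frac (G x - z) = frac (G t - z)"
    unfolding frac_def floor by (simp add: Gx)
  moreover have "\<lfloor>G t - z\<rfloor> = (if G t < z + 1 then 0 else 1)"
    using Gt assms(3,4) by (auto simp: floor_eq_iff)
  ultimately show ?thesis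
    using Gt by (auto simp: frac_def indicator_def)
qed

section \<open>Coding intervals and fixed-point-free lifts\<close>

lemma circle_bij_betw:
  assumes "g \<in> circle_homeos"
  shows "bij_betw g circle circle"
proof -
  obtain G where G: "is_lift G g" using assms by (auto simp: circle_homeos_def)
  have frac_G: "frac (G x) = g x" if "x \<in> circle" for x
    using frac_lift[OF G, of x] that by (simp add: frac_eq)
  \<comment> \<open>Injectivity: two distinct points of the circle with equal image would give
    lifted values differing by an integer strictly between 0 and 1.\<close>
  have le: "x \<le> y" if "x \<in> circle" "y \<in> circle" "g x = g y" for x y
  proof (rule ccontr)
    assume "\<not> x \<le> y"
    then have "G y < G x" "G x < G (y + 1)"
      using strict_monoD[OF lift_strict_mono[OF G]] that by auto
    then have "0 < G x - G y" "G x - G y < 1"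
      using lift_add_int[OF G, of y 1] by simp_all
    moreover have "G x - G y = of_int (\<lfloor>G x\<rfloor> - \<lfloor>G y\<rfloor>)"
      using frac_G[of x] frac_G[of y] that by (simp add: frac_def)
    ultimately show False
      by (metis of_int_0_less_iff of_int_less_1_iff zless_imp_add1_zle add_0 not_le)
  qed
  have "y \<in> g ` circle" if "y \<in> circle" for y
  proof -
    obtain x where "G x = y"
      using G unfolding is_lift_def lift_homeos_def homeomorphism_def by blast
    then have "g (frac x) = y" using frac_lift[OF G, of x] that by (simp add: frac_eq)
    then show ?thesis by (intro image_eqI[of _ _ "frac x"]) (auto simp: frac_lt_1)
  qed
  then show ?thesis
    using assms le by (auto simp: bij_betw_def inj_on_def circle_homeos_def intro: antisym)
qed

text \<open>The left endpoint of the coding interval is where the lift reaches 1, so membership of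
  \<open>y\<close> says that \<open>G y\<close> has floor 1; \<open>floor_lift_diff\<close> at
  \<open>z = 0\<close> turns this into a visit of the image. If \<open>g 0 = 0\<close>, both sets
  are empty by convention.\<close>

lemma in_coding_interval_iff:
  assumes "g \<in> circle_homeos" "is_lift G g" "G 0 \<in> {0..<1}" "y \<in> circle"
  shows "y \<in> coding_interval g \<longleftrightarrow> g y \<in> circle_arc 0 (g 0)"
proof (cases "g 0 = 0")
  case True
  then show ?thesis by (simp add: coding_interval_def circle_arc_def)
next
  case False
  define c where "c = the_inv_into circle g 0"
  note bij = circle_bij_betw[OF assms(1)]
  have c: "c \<in> circle" "g c = 0"
    using bij_betwE[OF bij_betw_the_inv_into[OF bij]] f_the_inv_into_f_bij_betw[OF bij, of 0]
    by (auto simp: c_def)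
  note mono = lift_strict_mono[OF assms(2)]
  have G0: "G 0 = g 0" using frac_lift[OF assms(2), of 0] assms(3) by (simp add: frac_eq)
  have "frac (G c) = 0" using frac_lift[OF assms(2), of c] c by (simp add: frac_eq)
  then obtain k where k: "G c = of_int k" by (auto simp: frac_eq_0_iff elim: Ints_cases)
  \<comment> \<open>Strict positivity comes from \<open>G 0 = g 0\<close>, which is nonzero here; 1
    is then the only integer left for \<open>G c\<close>.\<close>
  have "0 < G c" "G c < 2"
    using monoD[OF strict_mono_mono[OF mono], of 0 c] strict_monoD[OF mono, of c 1]
      lift_add_int[OF assms(2), of 0 1] c(1) assms(3) G0 False by auto
  then have Gc: "G c = 1"
    using k by simp
  have Gy: "0 \<le> G y" "G y < 2"
    using monoD[OF strict_mono_mono[OF mono], of 0 y] strict_monoD[OF mono, of y 1]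
      lift_add_int[OF assms(2), of 0 1] assms(3,4) by auto
  have "y \<in> coding_interval g \<longleftrightarrow> 1 \<le> G y"
    using strict_mono_less_eq[OF mono, of c y] Gc False assms(4)
    by (simp add: coding_interval_def c_def)
  also have "\<dots> \<longleftrightarrow> \<lfloor>G y\<rfloor> = 1" using Gy by linarith
  also have "\<dots> \<longleftrightarrow> g y \<in> circle_arc 0 (g 0)"
  proof -
    have "frac y = y" "\<lfloor>y\<rfloor> = 0" using assms(4) by (auto simp: frac_eq floor_eq_iff)
    then show ?thesis
      using floor_lift_diff[OF assms(2), of 0 y] assms(3)
      by (cases "g y \<in> circle_arc 0 (g 0)") simp_all
  qed
  finally show ?thesis .
qed

text \<open>An integer displacement would project to a fixed point. The displacements form an
  interval that avoids the integers and contains the one at 0, which lies in \<open>[0, 1)\<close>,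
  so all of them lie strictly between 0 and 1.\<close>

lemma fixed_point_free_lift:
  assumes "is_lift G g" "G 0 \<in> {0..<1}" "\<And>x. x \<in> circle \<Longrightarrow> g x \<noteq> x"
  shows "x < G x" "G x < x + 1"
proof -
  have no_int: "G y - y \<notin> \<int>" for y
  proof
    assume "G y - y \<in> \<int>"
    then obtain k where "G y = y + of_int k" by (metis Ints_cases add.commute diff_add_cancel)
    then have "g (frac y) = frac y" using frac_lift[OF assms(1), of y] by (simp add: frac_def)
    then show False using assms(3)[of "frac y"] by (simp add: frac_lt_1)
  qed
  have "connected ((\<lambda>y. G y - y) ` UNIV)"
    by (intro connected_continuous_image continuous_intros lift_continuous[OF assms(1)]) simp
  then have conn: "v \<in> range (\<lambda>y. G y - y)"
    if "G a - a \<le> v" "v \<le> G b - b" for a b v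
    using connectedD_interval[of "range (\<lambda>y. G y - y)" "G a - a" "G b - b" v] that by auto
  have "v \<notin> range (\<lambda>y. G y - y)" if "v \<in> \<int>" for v
    using no_int that by auto
  then have "0 \<notin> range (\<lambda>y. G y - y)" "1 \<notin> range (\<lambda>y. G y - y)"
    by simp_all
  then have "\<not> G x - x \<le> 0" "\<not> 1 \<le> G x - x"
    using conn[of x 0 0] conn[of 0 1 x] assms(2) by auto
  then show "x < G x" "G x < x + 1" by auto
qed

section \<open>Orbits, telescoping and limits\<close>

lemma (in measure_preserving_system) shift_iterate_in_space:
  assumes "\<omega> \<in> space M"
  shows "(\<sigma> ^^ n) \<omega> \<in> space M"
  using assms measurable_space[OF shift_measurable] by (induction n) auto

lemma iterate_in_circle:
  assumes "\<And>k. f ((\<sigma> ^^ k) \<omega>) \<in> circle \<rightarrow> circle" "x \<in> circle"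
  shows "iterate \<sigma> f n \<omega> x \<in> circle"
  using assms by (induction n) (auto simp: Pi_iff)

lemma frac_iterate_lift:
  assumes "\<And>k. is_lift (F ((\<sigma> ^^ k) \<omega>)) (f ((\<sigma> ^^ k) \<omega>))"
  shows "frac (iterate \<sigma> F n \<omega> x) = iterate \<sigma> f n \<omega> (frac x)"
  by (induction n) (simp_all add: frac_lift[OF assms])

text \<open>Reindexing by \<open>i = k + 1\<close> aligns the visits with the times
  \<open>k < n\<close> of the binary coding.\<close>

lemma visit_frequency_eq_sum:
  "visit_frequency \<sigma> f n \<omega> x z =
    (\<Sum>k<n. indicator (circle_arc z (f ((\<sigma> ^^ k) \<omega>) z)) (iterate \<sigma> f (Suc k) \<omega> x)) / real n"
proof -
  define P where "P i \<longleftrightarrow> iterate \<sigma> f i \<omega> x \<in> circle_arc z (f ((\<sigma> ^^ (i - 1)) \<omega>) z)" for i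
  have "real (card {i \<in> {1..n}. P i}) = (\<Sum>i=1..n. of_bool (P i))"
    by (simp add: sum_of_bool_eq Int_def)
  also have "\<dots> = (\<Sum>k<n. of_bool (P (Suc k)))"
    by (simp add: sum.atLeast1_atMost_eq)
  finally show ?thesis
    unfolding visit_frequency_def P_def[symmetric]
    by (simp add: P_def indicator_def of_bool_def)
qed

lemma visit_frequency_telescope:
  assumes "\<And>k. is_lift (F ((\<sigma> ^^ k) \<omega>)) (f ((\<sigma> ^^ k) \<omega>))"
    and "\<And>k. z \<le> F ((\<sigma> ^^ k) \<omega>) z" "\<And>k. F ((\<sigma> ^^ k) \<omega>) z < z + 1"
    and "x \<in> circle" "z \<in> circle"
  shows "visit_frequency \<sigma> f n \<omega> x z = (\<lfloor>iterate \<sigma> F n \<omega> x - z\<rfloor> - \<lfloor>x - z\<rfloor>) / real n"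
proof -
  define a where "a k = real_of_int \<lfloor>iterate \<sigma> F k \<omega> x - z\<rfloor>" for k
  \<comment> \<open>The lifted orbit may leave \<open>[0, 1)\<close>; its fractional part is the
    circle orbit, since \<open>frac x = x\<close>.\<close>
  have "indicator (circle_arc z (f ((\<sigma> ^^ k) \<omega>) z)) (iterate \<sigma> f (Suc k) \<omega> x) = a (Suc k) - a k"
    for k
    using floor_lift_diff[OF assms(1,5,2,3), of k "iterate \<sigma> F k \<omega> x"]
      frac_iterate_lift[of F \<sigma> \<omega> f k x] assms(1,4)
    by (simp add: a_def frac_eq)
  then have "visit_frequency \<sigma> f n \<omega> x z = (a n - a 0) / real n"
    by (simp only: visit_frequency_eq_sum sum_lessThan_telescope)
  then show ?thesis by (simp add: a_def)
qed

lemma visit_frequency_tendsto: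
  assumes "\<And>k. is_lift (F ((\<sigma> ^^ k) \<omega>)) (f ((\<sigma> ^^ k) \<omega>))"
    and "\<And>k. z \<le> F ((\<sigma> ^^ k) \<omega>) z" "\<And>k. F ((\<sigma> ^^ k) \<omega>) z < z + 1"
    and "x \<in> circle" "z \<in> circle"
    and "(\<lambda>n. (iterate \<sigma> F n \<omega> x - x) / real n) \<longlonglongrightarrow> r"
  shows "(\<lambda>n. visit_frequency \<sigma> f n \<omega> x z) \<longlonglongrightarrow> r"
proof (rule Lim_transform2[OF assms(6)])
  show "(\<lambda>n. (iterate \<sigma> F n \<omega> x - x) / real n - visit_frequency \<sigma> f n \<omega> x z) \<longlonglongrightarrow> 0"
  proof (rule Lim_null_comparison[OF always_eventually lim_inverse_n'], rule allI)
    fix n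
    \<comment> \<open>The left-hand side is the absolute difference of two fractional parts. After
      division the bound also covers \<open>n = 0\<close>, where every quotient is 0.\<close>
    have "\<bar>iterate \<sigma> F n \<omega> x - x - (\<lfloor>iterate \<sigma> F n \<omega> x - z\<rfloor> - \<lfloor>x - z\<rfloor>)\<bar> \<le> 1"
      by linarith
    then have "\<bar>iterate \<sigma> F n \<omega> x - x - (\<lfloor>iterate \<sigma> F n \<omega> x - z\<rfloor> - \<lfloor>x - z\<rfloor>)\<bar> / real n \<le> 1 / real n"
      by (rule divide_right_mono) simp
    then show "norm ((iterate \<sigma> F n \<omega> x - x) / real n - visit_frequency \<sigma> f n \<omega> x z) \<le> 1 / real n"
      by (simp add: visit_frequency_telescope[of F, OF assms(1-5)] diff_divide_distrib[symmetric])
  qed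
qed

theorem theorem3:
  fixes M :: "'w measure" and \<sigma> :: "'w \<Rightarrow> 'w"
    and f F :: "'w \<Rightarrow> real \<Rightarrow> real" and \<rho> :: "'w \<Rightarrow> real"
  assumes "measure_preserving_system M \<sigma>"
    and "f \<in> random_circle_homeos M"
    and "F \<in> integrable_random_lifts M"
    and "standard_lift M F f"
    and "random_rotation_number M \<sigma> F \<rho>"
  shows "(\<forall>x0\<in>circle. \<forall>n\<ge>1. \<forall>\<omega>\<in>space M.
            visit_frequency \<sigma> f n \<omega> x0 0 = coding_frequency \<sigma> f n \<omega> x0) \<and>
         (\<forall>x0\<in>circle. AE \<omega> in M. (\<lambda>n. visit_frequency \<sigma> f n \<omega> x0 0) \<longlonglongrightarrow> \<rho> \<omega>) \<and>
         ((\<forall>\<omega>\<in>space M. \<forall>x\<in>circle. f \<omega> x \<noteq> x) \<longrightarrow>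
            (\<forall>x0\<in>circle. \<forall>z\<in>circle. AE \<omega> in M.
               (\<lambda>n. visit_frequency \<sigma> f n \<omega> x0 z) \<longlonglongrightarrow> \<rho> \<omega>))"
proof -
  interpret measure_preserving_system M \<sigma> by fact
  have space: "space (borel_of (Metric_space.mtopology circle_homeos circle_dist)) = circle_homeos"
    by (auto simp: borel_of_def space_measure_of_conv
        Metric_space.topspace_mtopology[OF Metric_space_circle])
  have f: "f \<omega> \<in> circle_homeos" if "\<omega> \<in> space M" for \<omega>
    using measurable_space[OF assms(2)[unfolded random_circle_homeos_def] that] by (simp only: space)
  have F: "is_lift (F \<omega>) (f \<omega>)" "F \<omega> 0 \<in> {0..<1}" if "\<omega> \<in> space M" for \<omega>
    using assms(4) that by (auto simp: standard_lift_def random_lift_def)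
  \<comment> \<open>The facts \<open>f\<close> and \<open>F\<close> hold on \<open>space M\<close>
    only; this makes them available at every time along an orbit.\<close>
  note orbit = shift_iterate_in_space
  have rot: "AE \<omega> in M. (\<lambda>n. (iterate \<sigma> F n \<omega> x - x) / real n) \<longlonglongrightarrow> \<rho> \<omega>" for x
    using assms(5) by (simp add: random_rotation_number_def)
  have "visit_frequency \<sigma> f n \<omega> x0 0 = coding_frequency \<sigma> f n \<omega> x0"
    if x0: "x0 \<in> circle" and \<omega>: "\<omega> \<in> space M" for x0 n \<omega>
  proof -
    have "iterate \<sigma> f k \<omega> x0 \<in> circle" for k
      using f[OF orbit[OF \<omega>]] by (intro iterate_in_circle x0) (auto simp: circle_homeos_def)
    \<comment> \<open>The sums agree term by term: the coding condition at time \<open>k\<close> is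
      the visit condition for the next orbit point.\<close>
    then show ?thesis
      using in_coding_interval_iff[OF f[OF orbit[OF \<omega>]] F[OF orbit[OF \<omega>]]]
      by (simp add: visit_frequency_eq_sum coding_frequency_def indicator_def)
  qed
  moreover have "AE \<omega> in M. (\<lambda>n. visit_frequency \<sigma> f n \<omega> x0 0) \<longlonglongrightarrow> \<rho> \<omega>"
    if x0: "x0 \<in> circle" for x0
    using rot[of x0]
  proof (rule AE_mp, intro AE_I2 impI)
    fix \<omega> assume "\<omega> \<in> space M"
    then show "(\<lambda>n. visit_frequency \<sigma> f n \<omega> x0 0) \<longlonglongrightarrow> \<rho> \<omega>"
      if "(\<lambda>n. (iterate \<sigma> F n \<omega> x0 - x0) / real n) \<longlonglongrightarrow> \<rho> \<omega>"
      using F[OF orbit] x0 that by (intro visit_frequency_tendsto[of F]) auto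
  qed
  moreover have "AE \<omega> in M. (\<lambda>n. visit_frequency \<sigma> f n \<omega> x0 z) \<longlonglongrightarrow> \<rho> \<omega>"
    if free: "\<forall>\<omega>\<in>space M. \<forall>x\<in>circle. f \<omega> x \<noteq> x"
      and x0: "x0 \<in> circle" and z: "z \<in> circle" for x0 z
    \<comment> \<open>The exceptional null set is that of the rotation limit started at
      \<open>x0\<close>, the same for every \<open>z\<close>.\<close>
    using rot[of x0]
  proof (rule AE_mp, intro AE_I2 impI)
    fix \<omega> assume \<omega>: "\<omega> \<in> space M"
    show "(\<lambda>n. visit_frequency \<sigma> f n \<omega> x0 z) \<longlonglongrightarrow> \<rho> \<omega>"
      if lim: "(\<lambda>n. (iterate \<sigma> F n \<omega> x0 - x0) / real n) \<longlonglongrightarrow> \<rho> \<omega>"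
    proof (rule visit_frequency_tendsto[of F, OF F(1)[OF orbit[OF \<omega>]] _ _ x0 z lim])
      fix k
      show "z \<le> F ((\<sigma> ^^ k) \<omega>) z" "F ((\<sigma> ^^ k) \<omega>) z < z + 1"
        using fixed_point_free_lift[OF F[OF orbit[OF \<omega>, of k]], of z] free orbit[OF \<omega>, of k]
        by (auto intro: less_imp_le)
    qed
  qed
  ultimately show ?thesis by blast
qed

end
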